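(* Let $n>2$ be an integer and let $G=(V,E)$ be an undirected graph with $n$ vertices. If every vertex of $G$ has degree greater than $\frac n2$, then $G$ is propagative.
   Context: An undirected graph is a pair $G=(V,E)$ with $V$ a finite set and $E$ a set of $2$-element subsets of $V$. Define $\Phi=\Phi_G\colon\mathcal P(V)\to\mathcal P(V)$ by \[\Phi S=S\cup\{v\in V\mid \exists s_0,s_1\in S,\ s_0\neq s_1,\ \{s_0,v\}\in E\text{ and }\{s_1,v\}\in E\}.\] $G$ is called propagative if for every $S\subset V$ with $|S|=2$ there exists $k\ge 1$ such that $\Phi^kS=V$. *)

theory Defs
  imports Complex_Main
begin

locale undirected_graph =
  fixes V :: "'a set" and E :: "'a set set"
  assumes finite_V: "finite V"
    and edges_2_subsets: "\<And>e. e \<in> E \<Longrightarrow> e \<subseteq> V \<and> card e = 2"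

definition degree :: "'a set set \<Rightarrow> 'a \<Rightarrow> nat" where
  "degree E v = card {e \<in> E. v \<in> e}"

(* Phi is total on the type 'a set; it maps subsets of V to subsets of V. *)
definition Phi :: "'a set \<Rightarrow> 'a set set \<Rightarrow> 'a set \<Rightarrow> 'a set" where
  "Phi V E S = S \<union> {v \<in> V. \<exists>s0\<in>S. \<exists>s1\<in>S. s0 \<noteq> s1 \<and> {s0, v} \<in> E \<and> {s1, v} \<in> E}"

definition propagative :: "'a set \<Rightarrow> 'a set set \<Rightarrow> bool" where
  "propagative V E \<longleftrightarrow>
     (\<forall>S. S \<subseteq> V \<and> card S = 2 \<longrightarrow> (\<exists>k::nat. k \<ge> 1 \<and> (Phi V E ^^ k) S = V))"

end

theory Submission
  imports Defs
begin

text \<open>The iterates of \<open>\<Phi>\<close> on \<open>S\<close> increase, so they reach a fixed point \<open>T\<close>; write \<open>t = |T|\<close>, and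
  let all degrees be at least \<open>d\<close> with \<open>2 d > n\<close>. Suppose \<open>T \<noteq> V\<close>. A vertex outside \<open>T\<close> has at most
  one neighbour in \<open>T\<close>, so its degree is at most \<open>n - t\<close>, whence \<open>t < d\<close>. For the same
  reason the outer neighbourhoods of the vertices of \<open>T\<close> are pairwise disjoint; each has at least
  \<open>d - t + 1\<close> elements, so \<open>t (d - t + 1) \<le> n - t\<close>. But \<open>t (d - t + 2) = 2 d + (t - 2) (d - t) > n\<close>.\<close>

definition nbrs :: "'a set set \<Rightarrow> 'a \<Rightarrow> 'a set" where
  "nbrs E v = {u. {u, v} \<in> E}"

context undirected_graph
begin

lemma nbrs_subset: "nbrs E v \<subseteq> V"
  using edges_2_subsets by (auto simp: nbrs_def)

lemma finite_nbrs: "finite (nbrs E v)"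
  using nbrs_subset finite_V finite_subset by blast

lemma self_notin_nbrs: "v \<notin> nbrs E v"
  using edges_2_subsets[of "{v, v}"] by (auto simp: nbrs_def)

text \<open>The map \<open>u\<close> to \<open>{u, v}\<close> is a bijection onto the edges at
  \<open>v\<close>, surjective because every edge has exactly two elements.\<close>

lemma degree_eq_card_nbrs: "degree E v = card (nbrs E v)"
proof -
  have "{e \<in> E. v \<in> e} = (\<lambda>u. {u, v}) ` nbrs E v"
  proof (intro equalityI subsetI)
    fix e assume e: "e \<in> {e \<in> E. v \<in> e}"
    then obtain x y where "e = {x, y}"
      using edges_2_subsets[of e] by (auto simp: card_2_iff)
    with e show "e \<in> (\<lambda>u. {u, v}) ` nbrs E v"
      by (auto simp: nbrs_def insert_commute)
  qed (auto simp: nbrs_def)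
  moreover have "inj_on (\<lambda>u. {u, v}) (nbrs E v)"
    by (auto simp: inj_on_def doubleton_eq_iff)
  ultimately show ?thesis
    by (simp add: degree_def card_image)
qed

lemma Phi_subset: "S \<subseteq> V \<Longrightarrow> Phi V E S \<subseteq> V"
  by (auto simp: Phi_def)

lemma subset_Phi: "S \<subseteq> Phi V E S"
  by (auto simp: Phi_def)

lemma funpow_Phi_subset: "S \<subseteq> V \<Longrightarrow> (Phi V E ^^ k) S \<subseteq> V"
  by (induction k) (simp_all add: Phi_subset)

lemma subset_funpow_Phi: "S \<subseteq> (Phi V E ^^ k) S"
  by (induction k) (use subset_Phi in auto)

text \<open>Cardinalities of the iterates are bounded by \<open>card V\<close>; at an index
  \<open>k \<ge> 1\<close> where the maximum is attained, one more application cannot enlarge the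
  set.\<close>

lemma funpow_Phi_reaches_fixpoint:
  assumes "S \<subseteq> V"
  obtains k where "k \<ge> 1" "Phi V E ((Phi V E ^^ k) S) = (Phi V E ^^ k) S"
proof -
  let ?c = "\<lambda>k. card ((Phi V E ^^ k) S)"
  have "?c k \<le> card V" for k
    by (rule card_mono[OF finite_V funpow_Phi_subset[OF assms]])
  then obtain k where k: "k \<ge> 1" and max: "\<And>j. j \<ge> 1 \<Longrightarrow> ?c j \<le> ?c k"
    using ex_has_greatest_nat[of "\<lambda>k. k \<ge> 1" 1 ?c "Suc (card V)"] by (auto simp: less_Suc_eq_le)
  have "finite (Phi V E ((Phi V E ^^ k) S))"
    using finite_subset[OF funpow_Phi_subset[OF assms, of "Suc k"] finite_V] by simp
  then have "(Phi V E ^^ k) S = Phi V E ((Phi V E ^^ k) S)"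
    using card_seteq[OF _ subset_Phi] max[of "Suc k"] by simp
  with k that show ?thesis by simp
qed

text \<open>Two distinct neighbours in \<open>T\<close> would force \<open>Phi\<close> to add
  \<open>v\<close>.\<close>

lemma Phi_fixpoint_unique_nbr:
  assumes "Phi V E T = T" "v \<in> V - T" "a \<in> T" "b \<in> T" "v \<in> nbrs E a" "v \<in> nbrs E b"
  shows "a = b"
proof (rule ccontr)
  assume "a \<noteq> b"
  with assms have "v \<in> Phi V E T"
    unfolding Phi_def nbrs_def by (fastforce simp: insert_commute)
  with assms show False by blast
qed

lemma Phi_fixpoint_eq_V:
  assumes T: "T \<subseteq> V" "Phi V E T = T" "card T \<ge> 2"
    and deg: "\<And>v. v \<in> V \<Longrightarrow> d \<le> degree E v" and d: "card V < 2 * d"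
  shows "T = V"
proof (rule ccontr)
  assume "T \<noteq> V"
  with T obtain v where v: "v \<in> V - T" by blast
  have finT: "finite T" using T finite_V finite_subset by blast
  have card_diff: "card (V - T) + card T = card V"
    using card_mono[OF finite_V T(1)] by (simp add: card_Diff_subset[OF finT T(1)])
  \<comment> \<open>At most \<open>card T - 1\<close> neighbours of \<open>a\<close> lie in
    \<open>T\<close>, since \<open>a\<close> is not its own neighbour.\<close>
  have outer: "d \<le> card (nbrs E a - T) + (card T - 1)" if "a \<in> T" for a
  proof -
    have "nbrs E a \<subseteq> (nbrs E a - T) \<union> (T - {a})"
      using self_notin_nbrs by blast
    then have "card (nbrs E a) \<le> card ((nbrs E a - T) \<union> (T - {a}))"
      using finT finite_nbrs by (intro card_mono) auto
    also have "\<dots> \<le> card (nbrs E a - T) + card (T - {a})"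
      by (rule card_Un_le)
    finally show ?thesis
      using deg[of a] that T finT by (auto simp: degree_eq_card_nbrs)
  qed
  have "card (nbrs E v \<inter> T) \<le> Suc 0"
  proof -
    have "x = y" if "x \<in> nbrs E v \<inter> T" "y \<in> nbrs E v \<inter> T" for x y
      using Phi_fixpoint_unique_nbr[OF T(2) v, of x y] that
      by (auto simp: nbrs_def insert_commute)
    then show ?thesis
      using finT by (subst card_le_Suc0_iff_eq) auto
  qed
  \<comment> \<open>Excluding \<open>v\<close> itself offsets the one possible neighbour in
    \<open>T\<close>, so the degree of \<open>v\<close> is at most
    \<open>card (V - T)\<close>.\<close>
  moreover have "card (nbrs E v) \<le> card ((nbrs E v \<inter> T) \<union> (V - T - {v}))"
    using self_notin_nbrs nbrs_subset finite_V finT by (intro card_mono) auto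
  moreover have "\<dots> \<le> card (nbrs E v \<inter> T) + card (V - T - {v})"
    by (rule card_Un_le)
  moreover have "card (V - T - {v}) = card (V - T) - 1" "card (V - T) > 0"
    using v finite_V by (auto simp: card_gt_0_iff)
  ultimately have "d \<le> card (V - T)"
    using deg[of v] v by (simp add: degree_eq_card_nbrs)
  with card_diff d have t_less: "card T < d" by linarith
  have "card T * (d - (card T - 1)) \<le> (\<Sum>a\<in>T. card (nbrs E a - T))"
    using sum_bounded_below[of T "d - (card T - 1)" "\<lambda>a. card (nbrs E a - T)"] outer
    by fastforce
  also have "\<dots> = card (\<Union>a\<in>T. nbrs E a - T)"
  proof (rule card_UN_disjoint[symmetric])
    show "\<forall>a\<in>T. \<forall>b\<in>T. a \<noteq> b \<longrightarrow> (nbrs E a - T) \<inter> (nbrs E b - T) = {}"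
    proof (intro ballI impI equals0I)
      fix a b x assume ab: "a \<in> T" "b \<in> T" "a \<noteq> b"
        and x: "x \<in> (nbrs E a - T) \<inter> (nbrs E b - T)"
      then have "x \<in> V - T" using nbrs_subset by auto
      with ab x Phi_fixpoint_unique_nbr[OF T(2), of x a b] show False by simp
    qed
  qed (simp_all add: finT finite_nbrs)
  also have "\<dots> \<le> card (V - T)"
    using nbrs_subset finite_V by (intro card_mono) auto
  finally have le: "card T * (d - (card T - 1)) \<le> card (V - T)" .
  \<comment> \<open>Writing \<open>t = i + 2\<close> and \<open>d = t + j\<close> removes truncated
    subtraction: the count becomes \<open>(i + 2) * (j + 2) \<le> card V < 2 * (i + j + 2)\<close>,
    impossible because the left side exceeds the right by \<open>i * j \<ge> 0\<close>.\<close>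
  obtain i where i: "card T = i + 2"
    using T(3) by (metis le_add_diff_inverse2)
  obtain j where j: "d = card T + j"
    using t_less less_imp_add_positive by blast
  have "d - (card T - 1) = j + 1"
    using i j by simp
  then have "(i + 2) * (j + 1) + (i + 2) \<le> card V"
    using le card_diff i by simp
  with d i j show False
    by (simp add: algebra_simps)
qed

end

theorem proposition3p1p4:
  fixes n :: nat and V :: "'a set" and E :: "'a set set"
  assumes "n > 2"
    and "undirected_graph V E"
    and "card V = n"
    and "\<And>v. v \<in> V \<Longrightarrow> real (degree E v) > real n / 2"
  shows "propagative V E"
proof -
  interpret undirected_graph V E by fact
  show ?thesis
    unfolding propagative_def
  proof (intro allI impI, elim conjE)
    fix S assume S: "S \<subseteq> V" "card S = 2"
    obtain k where k: "k \<ge> 1" "Phi V E ((Phi V E ^^ k) S) = (Phi V E ^^ k) S"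
      using funpow_Phi_reaches_fixpoint[OF S(1)] .
    have "card S \<le> card ((Phi V E ^^ k) S)"
      by (rule card_mono[OF finite_subset[OF funpow_Phi_subset[OF S(1)] finite_V]
            subset_funpow_Phi])
    \<comment> \<open>Degrees are integers, and \<open>n div 2 + 1\<close> is the least integer
      above \<open>n / 2\<close>.\<close>
    moreover have "n div 2 + 1 \<le> degree E v" if "v \<in> V" for v
      using assms(4)[OF that] by linarith
    moreover have "card V < 2 * (n div 2 + 1)"
      using assms(3) by simp
    ultimately have "(Phi V E ^^ k) S = V"
      using Phi_fixpoint_eq_V[OF funpow_Phi_subset[OF S(1)] k(2), of "n div 2 + 1"] S(2) by simp
    with k(1) show "\<exists>k\<ge>1. (Phi V E ^^ k) S = V" by blast
  qed
qed

end
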